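(* Suppose $Y$ is binary ($Y\in\{0,1\}$ whenever $R_1=1$) and the odds ratio $$\rho=\frac{\mathrm{odds}(Y=1\mid R_1=R_2=1)}{\mathrm{odds}(Y=1\mid R_1=1)}$$ is known (the same fixed number for all distributions considered). For a distribution $\mathbb{P}$ of $O=(R_1,R_2,Y,X)$ let $$\xi(x)=\mathrm{odds}(Y=1\mid X=x,R_1=R_2=1),\qquad \varpi(x)=\frac{d\mathbb{P}(x\mid R_1=0,R_2=1)}{d\mathbb{P}(x\mid R_1=R_2=1)},$$ and $$\theta(\mathbb{P})=\mathbb{E}\left\{\frac{\xi(X)}{\rho+\xi(X)}\,\middle|\,R_1=0,R_2=1\right\}.$$ Then $\theta$ satisfies the von Mises expansion $$\theta(\overline{\mathbb{P}})-\theta(\mathbb{P})=\int\varphi(o;\overline{\mathbb{P}})\,d(\overline{\mathbb{P}}-\mathbb{P})(o)+R_\theta(\overline{\mathbb{P}};\mathbb{P}),$$ with influence function $\varphi(O;\mathbb{P})$ equal to $$\rho\left\{\frac{1+\xi(X)}{\rho+\xi(X)}\right\}^2\frac{R_1R_2\,\varpi(X)}{\mathbb{P}[R_1=R_2=1]}\left\{Y-\frac{\xi(X)}{1+\xi(X)}\right\}+\frac{(1-R_1)R_2}{\mathbb{P}[R_1=0,R_2=1]}\left\{\frac{\xi(X)}{\rho+\xi(X)}-\theta\right\}$$ and remainder $R_\theta(\overline{\mathbb{P}};\mathbb{P})$ given by \begin{align*} &\frac{\mathbb{E}(R_1R_2)}{\overline{\mathbb{E}}(R_1R_2)}\int\left(\frac{\xi}{\rho+\xi}-\frac{\overline\xi}{\rho+\overline\xi}\right)\left(\overline\varpi-\varpi\right)dP_{11}+\frac{\mathbb{E}(R_1R_2)}{\overline{\mathbb{E}}(R_1R_2)}\int\left(S_{2g}+\frac{S_{2f}\,\rho}{(\rho+\overline\xi)^2}\right)\overline\varpi\,dP_{11}\\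 &\quad+\left\{\frac{\mathbb{E}((1-R_1)R_2)}{\overline{\mathbb{E}}((1-R_1)R_2)}-\frac{\mathbb{E}(R_1R_2)}{\overline{\mathbb{E}}(R_1R_2)}\right\}\int\left(\frac{\overline\xi}{\rho+\overline\xi}-\frac{\xi}{\rho+\xi}\right)dP_{01}\\ &\quad+\left\{1-\frac{\mathbb{E}((1-R_1)R_2)}{\overline{\mathbb{E}}((1-R_1)R_2)}\right\}\left(\overline\theta-\theta\right), \end{align*} where $dP_{st}=d\mathbb{P}(x\mid R_1=s,R_2=t)$ and $S_{2f},S_{2g}$ are the second-order terms defined in the context.
   Context: Observed data: $O=(R_1,R_2,Y,X)$ with missingness indicators $R_1,R_2\in\{0,1\}$; $Y$ is observed when $R_1=1$ and equals a fixed missing symbol "?" when $R_1=0$; $X$ takes values in some measurable space when $R_2=1$ and equals "?" when $R_2=0$. Terms multiplied by a zero indicator are read as $0$. $\mathrm{odds}(A\mid B)=\mathbb{P}(A\mid B)/\{1-\mathbb{P}(A\mid B)\}$. (The functional $\theta$ is the binary-$Y$ form of $\mathbb{E}\big(\mathbb{E}\{Y/\zeta(Y)\mid R_1=R_2=1,X\}/\mathbb{E}\{1/\zeta(Y)\mid R_1=R_2=1,X\}\mid R_1=0,R_2=1\big)$ with $\zeta(Y)=\mathbb{P}[R_2=1\mid R_1=1,Y]$.) Notation: $\mathbb{P},\overline{\mathbb{P}}$ are two distributions of $O$, $\mathbb{E},\overline{\mathbb{E}}$ the corresponding expectations; barred quantities $\overline\xi,\overline\varpi,\overline\theta$ are defined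 as the unbarred ones with $\overline{\mathbb{P}}$ in place of $\mathbb{P}$ (with the same known $\rho$). $\varpi$ is the Radon–Nikodym derivative of the law of $X$ given $R_1=0,R_2=1$ with respect to the law of $X$ given $R_1=R_2=1$. "Influence function" is the (mean-zero) function $\varphi(\cdot;\mathbb{P})$ playing the role of first-order derivative of $\theta$ in the displayed von Mises expansion. Second-order terms: let $\mu(x)=\mathbb{P}[Y=1\mid X=x,R_1=R_2=1]$, so $\xi=\mu/(1-\mu)$, and similarly $\overline\mu$ under $\overline{\mathbb{P}}$. Then $$S_{2f}(x)=(\mu-\overline\mu)\left\{(1+\overline\xi)^2-(1+\overline\xi')^2\right\},\qquad S_{2g}(x)=(\xi-\overline\xi)\left\{\frac{\rho}{(\rho+\overline\xi)^2}-\frac{\rho}{(\rho+\overline\xi'')^2}\right\},$$ where (all functions evaluated at $x$) $\overline\xi'$ and $\overline\xi''$ are values between $\xi$ and $\overline\xi$ given by the mean value theorem such that $$\xi-\overline\xi=(\mu-\overline\mu)(1+\overline\xi')^2,\qquad \frac{\xi}{\rho+\xi}-\frac{\overline\xi}{\rho+\overline\xi}=(\xi-\overline\xi)\frac{\rho}{(\rho+\overline\xi'')^2}.$$ Regularity: under both distributions, $\rho\in(0,\infty)$, $\mu,\overline\mu\in(0,1)$, the events $\{R_1=R_2=1\}$ and $\{R_1=0,R_2=1\}$ have positive probability, the Radon–Nikodym derivatives $\varpi,\overline\varpi$ exist, the laws are mutually absolutely continuous so that the nuisance functions of each can be evaluated under the other, and all displayed integrals are finite. *)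

theory Defs
  imports "HOL-Probability.Probability"
begin

text \<open>The missing symbol ``?'' is \<^const>\<open>None\<close>. The measurable sets of \<open>missing_space M\<close>
  are those whose observed part is measurable in \<open>M\<close>.\<close>

definition missing_space :: "'a measure \<Rightarrow> 'a option measure" where
  "missing_space M = sigma (insert None (Some ` space M)) (insert {None} ((`) Some ` sets M))"

text \<open>An observation is a tuple \<open>(R\<^sub>1, R\<^sub>2, Y, X)\<close>, with the missingness indicators
  read as the reals 0 and 1.\<close>

type_synonym 'x obs = "bool \<times> bool \<times> real option \<times> 'x option"

definition R1 :: "'x obs \<Rightarrow> real" where "R1 \<omega> = of_bool (fst \<omega>)"
definition R2 :: "'x obs \<Rightarrow> real" where "R2 \<omega> = of_bool (fst (snd \<omega>))"
definition Y :: "'x obs \<Rightarrow> real option" where "Y \<omega> = fst (snd (snd \<omega>))"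
definition X :: "'x obs \<Rightarrow> 'x option" where "X \<omega> = snd (snd (snd \<omega>))"

definition obs_space :: "'x measure \<Rightarrow> 'x obs measure" where
  "obs_space M = count_space UNIV \<Otimes>\<^sub>M count_space UNIV \<Otimes>\<^sub>M missing_space borel \<Otimes>\<^sub>M missing_space M"

definition obs_distribution :: "'x measure \<Rightarrow> 'x obs measure \<Rightarrow> bool" where
  "obs_distribution M P \<longleftrightarrow> prob_space P \<and> sets P = sets (obs_space M) \<and>
     (AE \<omega> in P. (Y \<omega> = None \<longleftrightarrow> R1 \<omega> = 0) \<and> (X \<omega> = None \<longleftrightarrow> R2 \<omega> = 0))"

definition binary_outcome :: "'x obs measure \<Rightarrow> bool" where
  "binary_outcome P \<longleftrightarrow> (AE \<omega> in P. R1 \<omega> = 1 \<longrightarrow> Y \<omega> \<in> {Some 0, Some 1})"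

definition odds :: "real \<Rightarrow> real" where "odds p = p / (1 - p)"

definition odds_ratio :: "'x obs measure \<Rightarrow> real" where
  "odds_ratio P =
     odds (\<P>(\<omega> in P. Y \<omega> = Some 1 \<bar> R1 \<omega> = 1 \<and> R2 \<omega> = 1)) /
     odds (\<P>(\<omega> in P. Y \<omega> = Some 1 \<bar> R1 \<omega> = 1))"

text \<open>\<open>given P s t\<close> is the conditional distribution of the observation given
  \<open>R\<^sub>1 = s\<close> and \<open>R\<^sub>2 = t\<close>; \<open>X_law M P s t\<close> is the corresponding conditional law of \<open>X\<close>.
  For \<open>t = 1\<close> the latter puts no mass on \<^const>\<open>None\<close>.\<close>

definition given :: "'x obs measure \<Rightarrow> real \<Rightarrow> real \<Rightarrow> 'x obs measure" where
  "given P s t = uniform_measure P {\<omega> \<in> space P. R1 \<omega> = s \<and> R2 \<omega> = t}"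

definition X_law :: "'x measure \<Rightarrow> 'x obs measure \<Rightarrow> real \<Rightarrow> real \<Rightarrow> 'x option measure" where
  "X_law M P s t = distr (given P s t) (missing_space M) X"

text \<open>The conditional probability of \<open>Y = 1\<close> given \<open>X = x\<close> and \<open>R\<^sub>1 = R\<^sub>2 = 1\<close>: a measurable
  \<open>\<mu>\<close> such that the integral of \<open>\<mu>\<close> over \<open>A\<close> with respect to the law of \<open>X\<close> given
  \<open>R\<^sub>1 = R\<^sub>2 = 1\<close> is the probability of \<open>Y = 1\<close> and \<open>X \<in> A\<close> given \<open>R\<^sub>1 = R\<^sub>2 = 1\<close>.\<close>

definition mu :: "'x measure \<Rightarrow> 'x obs measure \<Rightarrow> 'x option \<Rightarrow> real" where
  "mu M P x = enn2real (RN_deriv (X_law M P 1 1)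
     (distr (density (given P 1 1) (indicator {\<omega> \<in> space P. Y \<omega> = Some 1})) (missing_space M) X) x)"

definition xi :: "'x measure \<Rightarrow> 'x obs measure \<Rightarrow> 'x option \<Rightarrow> real" where
  "xi M P x = odds (mu M P x)"

definition varpi :: "'x measure \<Rightarrow> 'x obs measure \<Rightarrow> 'x option \<Rightarrow> real" where
  "varpi M P x = enn2real (RN_deriv (X_law M P 1 1) (X_law M P 0 1) x)"

definition theta :: "'x measure \<Rightarrow> real \<Rightarrow> 'x obs measure \<Rightarrow> real" where
  "theta M \<rho> P = (\<integral>\<omega>. xi M P (X \<omega>) / (\<rho> + xi M P (X \<omega>)) \<partial>given P 0 1)"

text \<open>Where \<open>Y\<close> or \<open>X\<close> is missing, the factor involving it is multiplied by a zero indicator.\<close>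

definition phi :: "'x measure \<Rightarrow> real \<Rightarrow> 'x obs measure \<Rightarrow> 'x obs \<Rightarrow> real" where
  "phi M \<rho> P \<omega> =
     \<rho> * ((1 + xi M P (X \<omega>)) / (\<rho> + xi M P (X \<omega>)))\<^sup>2
       * (R1 \<omega> * R2 \<omega> * varpi M P (X \<omega>) / \<P>(\<omega>' in P. R1 \<omega>' = 1 \<and> R2 \<omega>' = 1))
       * (the (Y \<omega>) - xi M P (X \<omega>) / (1 + xi M P (X \<omega>)))
     + (1 - R1 \<omega>) * R2 \<omega> / \<P>(\<omega>' in P. R1 \<omega>' = 0 \<and> R2 \<omega>' = 1)
       * (xi M P (X \<omega>) / (\<rho> + xi M P (X \<omega>)) - theta M \<rho> P)"

text \<open>The intermediate values \<open>\<xi>'\<close> and \<open>\<xi>''\<close> provided by the mean value theorem for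
  \<open>m \<mapsto> m / (1 - m)\<close>, whose derivative \<open>(1 - m)\<^sup>-\<^sup>2\<close> is the square of 1 plus the odds, and for
  \<open>z \<mapsto> z / (\<rho> + z)\<close>. Here
  and below \<open>Pb\<close> is the barred distribution. Where \<open>\<mu>\<close> and its barred counterpart lie in
  \<open>(0,1)\<close> and \<open>\<rho> > 0\<close>, such values exist, and the products with them in \<open>S2f\<close> and \<open>S2g\<close> do
  not depend on the choice.\<close>

definition xi' :: "'x measure \<Rightarrow> 'x obs measure \<Rightarrow> 'x obs measure \<Rightarrow> 'x option \<Rightarrow> real" where
  "xi' M Pb P x = (SOME z. z \<in> closed_segment (xi M P x) (xi M Pb x) \<and>
     xi M P x - xi M Pb x = (mu M P x - mu M Pb x) * (1 + z)\<^sup>2)"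

definition xi'' :: "'x measure \<Rightarrow> real \<Rightarrow> 'x obs measure \<Rightarrow> 'x obs measure \<Rightarrow> 'x option \<Rightarrow> real" where
  "xi'' M \<rho> Pb P x = (SOME z. z \<in> closed_segment (xi M P x) (xi M Pb x) \<and>
     xi M P x / (\<rho> + xi M P x) - xi M Pb x / (\<rho> + xi M Pb x)
       = (xi M P x - xi M Pb x) * (\<rho> / (\<rho> + z)\<^sup>2))"

definition S2f :: "'x measure \<Rightarrow> 'x obs measure \<Rightarrow> 'x obs measure \<Rightarrow> 'x option \<Rightarrow> real" where
  "S2f M Pb P x = (mu M P x - mu M Pb x) * ((1 + xi M Pb x)\<^sup>2 - (1 + xi' M Pb P x)\<^sup>2)"

definition S2g :: "'x measure \<Rightarrow> real \<Rightarrow> 'x obs measure \<Rightarrow> 'x obs measure \<Rightarrow> 'x option \<Rightarrow> real" where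
  "S2g M \<rho> Pb P x = (xi M P x - xi M Pb x) *
     (\<rho> / (\<rho> + xi M Pb x)\<^sup>2 - \<rho> / (\<rho> + xi'' M \<rho> Pb P x)\<^sup>2)"

definition remainder :: "'x measure \<Rightarrow> real \<Rightarrow> 'x obs measure \<Rightarrow> 'x obs measure \<Rightarrow> real" where
  "remainder M \<rho> Pb P =
     (let r11 = (\<integral>\<omega>. R1 \<omega> * R2 \<omega> \<partial>P) / (\<integral>\<omega>. R1 \<omega> * R2 \<omega> \<partial>Pb);
          r01 = (\<integral>\<omega>. (1 - R1 \<omega>) * R2 \<omega> \<partial>P) / (\<integral>\<omega>. (1 - R1 \<omega>) * R2 \<omega> \<partial>Pb)
      in r11 * (\<integral>x. (xi M P x / (\<rho> + xi M P x) - xi M Pb x / (\<rho> + xi M Pb x))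
                     * (varpi M Pb x - varpi M P x) \<partial>X_law M P 1 1)
       + r11 * (\<integral>x. (S2g M \<rho> Pb P x + S2f M Pb P x * \<rho> / (\<rho> + xi M Pb x)\<^sup>2)
                     * varpi M Pb x \<partial>X_law M P 1 1)
       + (r01 - r11) * (\<integral>x. xi M Pb x / (\<rho> + xi M Pb x) - xi M P x / (\<rho> + xi M P x)
                          \<partial>X_law M P 0 1)
       + (1 - r01) * (theta M \<rho> Pb - theta M \<rho> P))"

end

theory Submission
  imports Defs
begin

text \<open>Write \<open>f z = z / (\<rho> + z)\<close> and let \<open>\<nu>\<close>, \<open>\<zeta>\<close> be the barred versions of \<open>\<mu>\<close>, \<open>\<xi>\<close>.
  Conditioning \<open>Y\<close> on \<open>X\<close> replaces the residual \<open>Y - \<nu>\<close> in the barred influence function by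
  \<open>\<mu> - \<nu>\<close>, and by 0 under the barred law. The second-order terms sum to the linearisation of
  \<open>f \<circ> odds\<close> at \<open>\<nu>\<close> minus the exact difference \<open>f \<xi> - f \<zeta>\<close>. Since \<open>\<varpi>\<close> turns
  \<open>dP\<^sub>1\<^sub>1\<close> into \<open>dP\<^sub>0\<^sub>1\<close>, everything except the two parameters cancels.\<close>

section \<open>Measurability of the coordinates of an observation\<close>

lemma measurable_Y [measurable]: "Y \<in> measurable (obs_space M) (missing_space borel)"
  unfolding Y_def[abs_def] obs_space_def by measurable

lemma measurable_X [measurable]: "X \<in> measurable (obs_space M) (missing_space M)"
  unfolding X_def[abs_def] obs_space_def by measurable

lemma measurable_R1 [measurable]: "R1 \<in> borel_measurable (obs_space M)"
  unfolding R1_def[abs_def] obs_space_def by measurable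

lemma measurable_R2 [measurable]: "R2 \<in> borel_measurable (obs_space M)"
  unfolding R2_def[abs_def] obs_space_def by measurable

lemma sets_missing_space:
  "sets (missing_space M) =
    sigma_sets (insert None (Some ` space M)) (insert {None} ((`) Some ` sets M))"
  unfolding missing_space_def by (rule sets_measure_of) (use sets.sets_into_space in fastforce)

text \<open>Real singletons are Borel, so their \<open>Some\<close>-images are among the generators.
  This is what makes the events \<open>Y \<omega> = Some y\<close> measurable.\<close>

lemma Some_singleton_in_missing_space: "{Some y} \<in> sets (missing_space (borel :: real measure))"
proof -
  have "Some ` {y} \<in> (`) Some ` sets (borel :: real measure)"
    by (rule imageI) simp
  then show ?thesis
    unfolding sets_missing_space by (intro sigma_sets.Basic) simp
qed

text \<open>The Radon-Nikodym derivative of a finite measure is finite almost everywhere, so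
  \<open>enn2real\<close> changes it only on a null set. Both \<open>mu\<close> and
  \<open>varpi\<close> are such real versions and get their defining property from here.\<close>

lemma density_enn2real_RN_deriv:
  assumes "finite_measure M" "finite_measure N" "absolutely_continuous M N" "sets N = sets M"
  shows "density M (\<lambda>x. ennreal (enn2real (RN_deriv M N x))) = N"
proof -
  interpret M: finite_measure M by fact
  interpret N: finite_measure N by fact
  have "AE x in M. RN_deriv M N x \<noteq> \<infinity>"
    by (rule M.RN_deriv_finite) (use assms N.sigma_finite_measure_axioms in auto)
  then have "density M (\<lambda>x. ennreal (enn2real (RN_deriv M N x))) = density M (RN_deriv M N)"
    by (intro density_cong) (auto simp: less_top)
  also have "\<dots> = N"
    by (rule M.density_RN_deriv) (use assms in auto)
  finally show ?thesis .
qed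

section \<open>Conditional laws given the missingness pattern\<close>

locale observation =
  fixes M :: "'x measure" and P :: "'x obs measure"
  assumes obs_distribution: "obs_distribution M P"

sublocale observation \<subseteq> prob_space P
  using obs_distribution by (simp add: obs_distribution_def)

context observation
begin

lemma sets_P [measurable_cong, simp]: "sets P = sets (obs_space M)"
  using obs_distribution by (simp add: obs_distribution_def)

lemma event_Y [measurable]: "{\<omega> \<in> space P. Y \<omega> = Some y} \<in> sets P"
proof -
  have "{\<omega> \<in> space P. Y \<omega> = Some y} = Y -` {Some y} \<inter> space P"
    by auto
  also have "\<dots> \<in> sets P"
    by (rule measurable_sets[OF _ Some_singleton_in_missing_space]) measurable
  finally show ?thesis .
qed

lemma event_R [measurable]: "{\<omega> \<in> space P. R1 \<omega> = s \<and> R2 \<omega> = t} \<in> sets P"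
  by measurable

lemma sets_given [measurable_cong, simp]: "sets (given P s t) = sets (obs_space M)"
  by (simp add: given_def)

lemma space_given [simp]: "space (given P s t) = space P"
  by (simp add: given_def)

lemma sets_X_law [measurable_cong, simp]: "sets (X_law M P s t) = sets (missing_space M)"
  by (simp add: X_law_def)

text \<open>\<open>uniform_measure\<close> weights by a quotient in \<open>ennreal\<close>. Positive
  probability of the event turns it into a real density, the form required by
  \<open>integral_density\<close> and \<open>integrable_density\<close>.\<close>

lemma given_eq_density:
  assumes "\<P>(\<omega> in P. R1 \<omega> = s \<and> R2 \<omega> = t) > 0"
  shows "given P s t = density P (\<lambda>\<omega>. ennreal (indicator {\<omega> \<in> space P. R1 \<omega> = s \<and> R2 \<omega> = t} \<omega>
           / \<P>(\<omega> in P. R1 \<omega> = s \<and> R2 \<omega> = t)))"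
  unfolding given_def uniform_measure_def
proof (rule density_cong)
  show "AE \<omega> in P. indicator {\<omega> \<in> space P. R1 \<omega> = s \<and> R2 \<omega> = t} \<omega> /
        emeasure P {\<omega> \<in> space P. R1 \<omega> = s \<and> R2 \<omega> = t} =
      ennreal (indicator {\<omega> \<in> space P. R1 \<omega> = s \<and> R2 \<omega> = t} \<omega>
        / \<P>(\<omega> in P. R1 \<omega> = s \<and> R2 \<omega> = t))"
    using assms by (auto simp: emeasure_eq_measure divide_ennreal ennreal_indicator[symmetric]
        simp del: ennreal_indicator)
qed measurable

lemma
  fixes h :: "'x obs \<Rightarrow> real"
  assumes "\<P>(\<omega> in P. R1 \<omega> = s \<and> R2 \<omega> = t) > 0" "h \<in> borel_measurable (obs_space M)"
  shows integrable_given: "integrable (given P s t) h \<longleftrightarrow>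
      integrable P (\<lambda>\<omega>. indicator {\<omega> \<in> space P. R1 \<omega> = s \<and> R2 \<omega> = t} \<omega> * h \<omega>)"
    and integral_given: "(\<integral>\<omega>. h \<omega> \<partial>given P s t) =
      (\<integral>\<omega>. indicator {\<omega> \<in> space P. R1 \<omega> = s \<and> R2 \<omega> = t} \<omega> * h \<omega> \<partial>P)
        / \<P>(\<omega> in P. R1 \<omega> = s \<and> R2 \<omega> = t)"
proof -
  let ?E = "{\<omega> \<in> space P. R1 \<omega> = s \<and> R2 \<omega> = t}" and ?p = "\<P>(\<omega> in P. R1 \<omega> = s \<and> R2 \<omega> = t)"
  have [measurable]: "h \<in> borel_measurable P"
    using assms(2) by simp
  have eq: "(indicator ?E \<omega> / ?p) *\<^sub>R h \<omega> = indicator ?E \<omega> * h \<omega> / ?p" for \<omega>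
    by simp
  have nn: "AE \<omega> in P. 0 \<le> indicator ?E \<omega> / ?p"
    by simp
  have m: "(\<lambda>\<omega>. indicator ?E \<omega> / ?p) \<in> borel_measurable P"
    by (intro borel_measurable_divide borel_measurable_indicator event_R) simp
  show "integrable (given P s t) h \<longleftrightarrow> integrable P (\<lambda>\<omega>. indicator ?E \<omega> * h \<omega>)"
    unfolding given_eq_density[OF assms(1)]
    using assms(1) by (subst integrable_density[OF _ m nn]) (simp_all only: eq, auto simp: divide_inverse)
  show "(\<integral>\<omega>. h \<omega> \<partial>given P s t) = (\<integral>\<omega>. indicator ?E \<omega> * h \<omega> \<partial>P) / ?p"
    unfolding given_eq_density[OF assms(1)]
    by (subst integral_density[OF _ m nn]) (simp_all only: eq Bochner_Integration.integral_divide_zero, auto)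
qed

lemma prob_space_given:
  assumes "\<P>(\<omega> in P. R1 \<omega> = s \<and> R2 \<omega> = t) > 0"
  shows "prob_space (given P s t)"
  unfolding given_def by (rule prob_space_uniform_measure) (use assms in \<open>auto simp: emeasure_eq_measure\<close>)

lemma prob_space_X_law:
  assumes "\<P>(\<omega> in P. R1 \<omega> = s \<and> R2 \<omega> = t) > 0"
  shows "prob_space (X_law M P s t)"
  unfolding X_law_def by (rule prob_space.prob_space_distr[OF prob_space_given[OF assms]]) measurable

lemma borel_measurable_mu [measurable]: "mu M P \<in> borel_measurable (missing_space M)"
proof -
  have "mu M P \<in> borel_measurable (X_law M P 1 1)"
    unfolding mu_def[abs_def] by measurable
  then show ?thesis
    by (simp add: measurable_cong_sets[OF sets_X_law refl])
qed

lemma borel_measurable_xi [measurable]: "xi M P \<in> borel_measurable (missing_space M)"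
  unfolding xi_def[abs_def] odds_def by measurable

lemma borel_measurable_varpi [measurable]: "varpi M P \<in> borel_measurable (missing_space M)"
proof -
  have "varpi M P \<in> borel_measurable (X_law M P 1 1)"
    unfolding varpi_def[abs_def] by measurable
  then show ?thesis
    by (simp add: measurable_cong_sets[OF sets_X_law refl])
qed

lemma integral_X_law:
  fixes h :: "'x option \<Rightarrow> real"
  assumes "h \<in> borel_measurable (missing_space M)"
  shows "(\<integral>x. h x \<partial>X_law M P s t) = (\<integral>\<omega>. h (X \<omega>) \<partial>given P s t)"
    and "integrable (X_law M P s t) h \<longleftrightarrow> integrable (given P s t) (\<lambda>\<omega>. h (X \<omega>))"
  unfolding X_law_def using assms
  by (auto simp: integral_distr integrable_distr_eq)

lemma AE_X_law:
  assumes "AE x in X_law M P s t. S x"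
  shows "AE \<omega> in given P s t. S (X \<omega>)"
  by (rule AE_distrD[OF _ assms[unfolded X_law_def]]) measurable

lemma AE_given: "AE \<omega> in given P s t. R1 \<omega> = s \<and> R2 \<omega> = t"
  unfolding given_def by (rule AE_uniform_measureI[OF event_R]) auto

text \<open>Matches the expectations in \<open>remainder\<close> with the probabilities by which
  \<open>phi\<close> is normalised.\<close>

lemma integral_indicators:
  "(\<integral>\<omega>. R1 \<omega> * R2 \<omega> \<partial>P) = \<P>(\<omega> in P. R1 \<omega> = 1 \<and> R2 \<omega> = 1)"
  "(\<integral>\<omega>. (1 - R1 \<omega>) * R2 \<omega> \<partial>P) = \<P>(\<omega> in P. R1 \<omega> = 0 \<and> R2 \<omega> = 1)"
proof -
  have "(\<integral>\<omega>. R1 \<omega> * R2 \<omega> \<partial>P) = (\<integral>\<omega>. indicator {\<omega> \<in> space P. R1 \<omega> = 1 \<and> R2 \<omega> = 1} \<omega> \<partial>P)"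
    by (rule Bochner_Integration.integral_cong) (auto simp: R1_def R2_def)
  then show "(\<integral>\<omega>. R1 \<omega> * R2 \<omega> \<partial>P) = \<P>(\<omega> in P. R1 \<omega> = 1 \<and> R2 \<omega> = 1)"
    by (simp add: Int_def conj_ac)
  have "(\<integral>\<omega>. (1 - R1 \<omega>) * R2 \<omega> \<partial>P) = (\<integral>\<omega>. indicator {\<omega> \<in> space P. R1 \<omega> = 0 \<and> R2 \<omega> = 1} \<omega> \<partial>P)"
    by (rule Bochner_Integration.integral_cong) (auto simp: R1_def R2_def)
  then show "(\<integral>\<omega>. (1 - R1 \<omega>) * R2 \<omega> \<partial>P) = \<P>(\<omega> in P. R1 \<omega> = 0 \<and> R2 \<omega> = 1)"
    by (simp add: Int_def conj_ac)
qed

end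

section \<open>Conditioning the outcome on the covariate among complete cases\<close>

locale outcome_observation = observation M P
  for M :: "'x measure" and P :: "'x obs measure" +
  assumes pos11: "\<P>(\<omega> in P. R1 \<omega> = 1 \<and> R2 \<omega> = 1) > 0"
    and mu_bounds: "AE x in X_law M P 1 1. 0 < mu M P x \<and> mu M P x < 1"
begin

abbreviation "Q \<equiv> given P 1 1"
abbreviation "Y1 \<equiv> {\<omega> \<in> space P. Y \<omega> = Some 1}"

text \<open>The event \<open>B\<close> is kept general to serve both \<open>Y1\<close> and its
  complement.\<close>

lemma emeasure_outcome_law:
  assumes "B \<in> sets P" "A \<in> sets (missing_space M)"
  shows "emeasure (distr (density Q (indicator B)) (missing_space M) X) A =
    emeasure Q (B \<inter> (X -` A \<inter> space P))"
proof -
  have [measurable]: "X -` A \<inter> space P \<in> sets (obs_space M)"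
    using measurable_sets[of X P "missing_space M" A] assms by simp
  show ?thesis
    using assms by (subst emeasure_distr) (auto simp: emeasure_restricted)
qed

lemma density_mu:
  "density (X_law M P 1 1) (\<lambda>x. ennreal (mu M P x)) =
    distr (density Q (indicator Y1)) (missing_space M) X"
  unfolding mu_def
proof (rule density_enn2real_RN_deriv)
  interpret Q: prob_space Q by (rule prob_space_given[OF pos11])
  interpret L: prob_space "X_law M P 1 1" by (rule prob_space_X_law[OF pos11])
  note em = emeasure_outcome_law[OF event_Y]
  show "finite_measure (X_law M P 1 1)" by unfold_locales
  show "finite_measure (distr (density Q (indicator Y1)) (missing_space M) X)"
    by (rule finite_measureI) (simp add: em[OF sets.top])
  \<comment> \<open>Intersecting with \<open>Y1\<close> can only decrease the measure, so null sets
    of the law of \<open>X\<close> stay null.\<close>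
  show "absolutely_continuous (X_law M P 1 1) (distr (density Q (indicator Y1)) (missing_space M) X)"
    unfolding absolutely_continuous_def
  proof
    fix A assume A: "A \<in> null_sets (X_law M P 1 1)"
    then have *: "A \<in> sets (missing_space M)" by auto
    have [measurable]: "X -` A \<inter> space P \<in> sets (obs_space M)"
      using measurable_sets[of X P "missing_space M" A] * by simp
    have "emeasure Q (X -` A \<inter> space P) = 0"
      using A * by (simp add: X_law_def null_sets_def emeasure_distr)
    then have "emeasure Q (Y1 \<inter> (X -` A \<inter> space P)) = 0"
      by (rule emeasure_eq_0[rotated]) auto
    then show "A \<in> null_sets (distr (density Q (indicator Y1)) (missing_space M) X)"
      using em[OF *] * by (auto simp: null_sets_def)
  qed
qed simp

text \<open>The laws of \<open>X\<close> restricted to \<open>Y1\<close> and to its complement add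
  up to the whole law, which has density 1. By \<open>mu_bounds\<close> the weights
  \<open>mu\<close> and \<open>1 - mu\<close> are nonnegative almost everywhere and also add up to
  1, so removing the \<open>Y1\<close> part given by \<open>density_mu\<close> leaves the
  claim.\<close>

lemma density_1_minus_mu:
  "density (X_law M P 1 1) (\<lambda>x. ennreal (1 - mu M P x)) =
    distr (density Q (indicator (space P - Y1))) (missing_space M) X"
proof (rule measure_eqI)
  fix A assume "A \<in> sets (density (X_law M P 1 1) (\<lambda>x. ennreal (1 - mu M P x)))"
  then have A[measurable]: "A \<in> sets (missing_space M)" by simp
  interpret Q: prob_space Q by (rule prob_space_given[OF pos11])
  let ?N = "\<lambda>B. emeasure (distr (density Q (indicator B)) (missing_space M) X) A"
  have XA[measurable]: "X -` A \<inter> space P \<in> sets (obs_space M)"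
    using measurable_sets[of X P "missing_space M" A] A by simp
  note em = emeasure_outcome_law[OF _ A]
  have Y1: "Y1 \<in> sets (obs_space M)" "space P - Y1 \<in> sets (obs_space M)"
    using event_Y[of 1] sets.compl_sets[OF event_Y[of 1]] by simp_all
  have "?N Y1 + ?N (space P - Y1) = emeasure Q ((Y1 \<inter> (X -` A \<inter> space P)) \<union> ((space P - Y1) \<inter> (X -` A \<inter> space P)))"
    unfolding em[OF event_Y] em[OF sets.compl_sets[OF event_Y]]
    by (rule plus_emeasure) (use XA Y1 in auto)
  also have "(Y1 \<inter> (X -` A \<inter> space P)) \<union> ((space P - Y1) \<inter> (X -` A \<inter> space P)) = X -` A \<inter> space P"
    by auto
  also have "emeasure Q \<dots> = emeasure (X_law M P 1 1) A"
    by (simp add: X_law_def emeasure_distr)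
  also have "\<dots> = (\<integral>\<^sup>+x. ennreal (mu M P x) * indicator A x + ennreal (1 - mu M P x) * indicator A x \<partial>X_law M P 1 1)"
  proof -
    have "AE x in X_law M P 1 1.
      ennreal (mu M P x) * indicator A x + ennreal (1 - mu M P x) * indicator A x = indicator A x"
      using mu_bounds
      by eventually_elim (auto simp: indicator_def simp flip: ennreal_plus)
    from nn_integral_cong_AE[OF this] show ?thesis by simp
  qed
  also have "\<dots> = emeasure (density (X_law M P 1 1) (\<lambda>x. ennreal (mu M P x))) A
      + emeasure (density (X_law M P 1 1) (\<lambda>x. ennreal (1 - mu M P x))) A"
    by (subst nn_integral_add) (auto simp: emeasure_density)
  also have "\<dots> = ?N Y1 + emeasure (density (X_law M P 1 1) (\<lambda>x. ennreal (1 - mu M P x))) A"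
    by (simp add: density_mu)
  \<comment> \<open>Cancelling a summand in \<open>ennreal\<close> requires it to be finite; here it
    is bounded by the total mass of \<open>Q\<close>.\<close>
  finally show "emeasure (density (X_law M P 1 1) (\<lambda>x. ennreal (1 - mu M P x))) A = ?N (space P - Y1)"
    by (simp add: ennreal_add_left_cancel em[OF event_Y])
qed simp

text \<open>Each pair integrates \<open>h\<close> against one measure in two ways: as the image
  under \<open>X\<close> of \<open>Q\<close> restricted to an outcome event, and as a density over
  the law of \<open>X\<close>.\<close>

lemma
  fixes h :: "'x option \<Rightarrow> real"
  assumes [measurable]: "h \<in> borel_measurable (missing_space M)"
  shows integrable_outcome_1: "integrable Q (\<lambda>\<omega>. indicator Y1 \<omega> * h (X \<omega>)) \<longleftrightarrow>
      integrable (X_law M P 1 1) (\<lambda>x. mu M P x * h x)"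
    and integral_outcome_1: "(\<integral>\<omega>. indicator Y1 \<omega> * h (X \<omega>) \<partial>Q) = (\<integral>x. mu M P x * h x \<partial>X_law M P 1 1)"
    and integrable_outcome_0: "integrable Q (\<lambda>\<omega>. indicator (space P - Y1) \<omega> * h (X \<omega>)) \<longleftrightarrow>
      integrable (X_law M P 1 1) (\<lambda>x. (1 - mu M P x) * h x)"
    and integral_outcome_0: "(\<integral>\<omega>. indicator (space P - Y1) \<omega> * h (X \<omega>) \<partial>Q) =
      (\<integral>x. (1 - mu M P x) * h x \<partial>X_law M P 1 1)"
proof -
  have mu: "AE x in X_law M P 1 1. 0 \<le> mu M P x" "AE x in X_law M P 1 1. 0 \<le> 1 - mu M P x"
    using mu_bounds by auto
  have *: "integrable (distr (density Q (\<lambda>\<omega>. ennreal (indicator B \<omega>))) (missing_space M) X) h \<longleftrightarrow>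
        integrable Q (\<lambda>\<omega>. indicator B \<omega> * h (X \<omega>))"
      "(\<integral>x. h x \<partial>distr (density Q (\<lambda>\<omega>. ennreal (indicator B \<omega>))) (missing_space M) X) =
        (\<integral>\<omega>. indicator B \<omega> * h (X \<omega>) \<partial>Q)"
    if [measurable]: "B \<in> sets P" for B
  proof -
    have [measurable]: "B \<in> sets (obs_space M)" using that by simp
    show "integrable (distr (density Q (\<lambda>\<omega>. ennreal (indicator B \<omega>))) (missing_space M) X) h \<longleftrightarrow>
        integrable Q (\<lambda>\<omega>. indicator B \<omega> * h (X \<omega>))"
      by (subst integrable_distr_eq, measurable) (subst integrable_density; simp)
    show "(\<integral>x. h x \<partial>distr (density Q (\<lambda>\<omega>. ennreal (indicator B \<omega>))) (missing_space M) X) =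
        (\<integral>\<omega>. indicator B \<omega> * h (X \<omega>) \<partial>Q)"
      by (subst integral_distr, measurable) (subst integral_density; simp)
  qed
  have **: "integrable (density (X_law M P 1 1) (\<lambda>x. ennreal (g x))) h \<longleftrightarrow>
        integrable (X_law M P 1 1) (\<lambda>x. g x * h x)"
      "(\<integral>x. h x \<partial>density (X_law M P 1 1) (\<lambda>x. ennreal (g x))) = (\<integral>x. g x * h x \<partial>X_law M P 1 1)"
    if "g \<in> borel_measurable (missing_space M)" "AE x in X_law M P 1 1. 0 \<le> g x" for g
    using that by (simp_all add: integrable_density integral_density)
  show "integrable Q (\<lambda>\<omega>. indicator Y1 \<omega> * h (X \<omega>)) \<longleftrightarrow>
      integrable (X_law M P 1 1) (\<lambda>x. mu M P x * h x)"
    "(\<integral>\<omega>. indicator Y1 \<omega> * h (X \<omega>) \<partial>Q) = (\<integral>x. mu M P x * h x \<partial>X_law M P 1 1)"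
    using *[OF event_Y[of 1]] **[of "mu M P"] mu density_mu by (simp_all add: ennreal_indicator)
  show "integrable Q (\<lambda>\<omega>. indicator (space P - Y1) \<omega> * h (X \<omega>)) \<longleftrightarrow>
      integrable (X_law M P 1 1) (\<lambda>x. (1 - mu M P x) * h x)"
    "(\<integral>\<omega>. indicator (space P - Y1) \<omega> * h (X \<omega>) \<partial>Q) =
      (\<integral>x. (1 - mu M P x) * h x \<partial>X_law M P 1 1)"
    using *[OF sets.compl_sets[OF event_Y[of 1]]] **[of "\<lambda>x. 1 - mu M P x"] mu density_1_minus_mu
    by (simp_all add: ennreal_indicator)
qed

text \<open>Splitting by the value of \<open>Y\<close> avoids assuming that \<open>g(X)\<close> alone is integrable.\<close>

lemma residual:
  fixes g m :: "'x option \<Rightarrow> real"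
  assumes [measurable]: "g \<in> borel_measurable (missing_space M)" "m \<in> borel_measurable (missing_space M)"
    and int: "integrable Q (\<lambda>\<omega>. g (X \<omega>) * (indicator Y1 \<omega> - m (X \<omega>)))"
  shows integrable_residual: "integrable (X_law M P 1 1) (\<lambda>x. g x * (mu M P x - m x))"
    and integral_residual: "(\<integral>\<omega>. g (X \<omega>) * (indicator Y1 \<omega> - m (X \<omega>)) \<partial>Q) =
      (\<integral>x. g x * (mu M P x - m x) \<partial>X_law M P 1 1)"
proof -
  let ?L = "X_law M P 1 1" and ?a = "\<lambda>x. g x * (1 - m x)" and ?b = "\<lambda>x. - (g x * m x)"
  have Y1: "Y1 \<in> sets Q" using event_Y[of 1] by simp
  \<comment> \<open>On \<open>Y1\<close> the residual product equals \<open>?a\<close>, off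
    \<open>Y1\<close> it equals \<open>?b\<close>. Each restricted function therefore inherits
    integrability from the whole product.\<close>
  have a: "integrable Q (\<lambda>\<omega>. indicator Y1 \<omega> * ?a (X \<omega>))"
    using integrable_mult_indicator[OF Y1 int]
    by (rule Bochner_Integration.integrable_bound) (auto simp: indicator_def intro: borel_measurable_integrable)
  have b: "integrable Q (\<lambda>\<omega>. indicator (space P - Y1) \<omega> * ?b (X \<omega>))"
    using integrable_mult_indicator[OF sets.compl_sets[OF Y1] int]
    by (rule Bochner_Integration.integrable_bound) (auto simp: indicator_def)
  have split: "(\<integral>\<omega>. g (X \<omega>) * (indicator Y1 \<omega> - m (X \<omega>)) \<partial>Q) =
      (\<integral>\<omega>. indicator Y1 \<omega> * ?a (X \<omega>) + indicator (space P - Y1) \<omega> * ?b (X \<omega>) \<partial>Q)"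
    by (rule Bochner_Integration.integral_cong) (auto simp: indicator_def)
  have a': "integrable ?L (\<lambda>x. mu M P x * ?a x)"
    using a by (subst integrable_outcome_1[symmetric]) auto
  have b': "integrable ?L (\<lambda>x. (1 - mu M P x) * ?b x)"
    using b by (subst integrable_outcome_0[symmetric]) auto
  \<comment> \<open>Averaging the two residuals with weights \<mu> and 1 - \<mu> gives \<mu> (1 - m)
    - (1 - \<mu>) m = \<mu> - m.\<close>
  have eq: "g x * (mu M P x - m x) = mu M P x * ?a x + (1 - mu M P x) * ?b x" for x
    by (simp add: algebra_simps)
  show "integrable ?L (\<lambda>x. g x * (mu M P x - m x))"
    unfolding eq using a' b' by (rule Bochner_Integration.integrable_add)
  show "(\<integral>\<omega>. g (X \<omega>) * (indicator Y1 \<omega> - m (X \<omega>)) \<partial>Q) = (\<integral>x. g x * (mu M P x - m x) \<partial>?L)"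
    unfolding split eq
    unfolding Bochner_Integration.integral_add[OF a b] Bochner_Integration.integral_add[OF a' b']
    using integral_outcome_1[of ?a] integral_outcome_0[of ?b]
    by (simp only: assms borel_measurable_times borel_measurable_diff borel_measurable_const borel_measurable_uminus)
qed

section \<open>The density ratio and the mean of the influence function\<close>

lemma density_varpi:
  assumes "\<P>(\<omega> in P. R1 \<omega> = 0 \<and> R2 \<omega> = 1) > 0"
    and "absolutely_continuous (X_law M P 1 1) (X_law M P 0 1)"
  shows "density (X_law M P 1 1) (\<lambda>x. ennreal (varpi M P x)) = X_law M P 0 1"
  unfolding varpi_def
  by (rule density_enn2real_RN_deriv)
    (use prob_space_X_law[OF pos11] prob_space_X_law[OF assms(1)] assms(2) in
      \<open>auto simp: prob_space_def\<close>)

text \<open>The averaging law \<open>P\<close> and the law \<open>Pb\<close> defining the influence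
  function are kept separate. Taking them equal gives the mean-zero property; taking them different
  gives the cross term of the expansion. The integrability claims are extracted from that of
  \<open>phi\<close> alone.\<close>

lemma influence_function_mean:
  assumes Pb: "observation M Pb"
    and binary: "binary_outcome P"
    and pos01: "\<P>(\<omega> in P. R1 \<omega> = 0 \<and> R2 \<omega> = 1) > 0"
    and posb: "\<P>(\<omega> in Pb. R1 \<omega> = 1 \<and> R2 \<omega> = 1) > 0" "\<P>(\<omega> in Pb. R1 \<omega> = 0 \<and> R2 \<omega> = 1) > 0"
    and mub: "AE x in X_law M P 1 1. 0 < mu M Pb x \<and> mu M Pb x < 1"
    and int: "integrable P (phi M \<rho> Pb)"
  defines "g \<equiv> \<lambda>x. \<rho> * ((1 + xi M Pb x) / (\<rho> + xi M Pb x))\<^sup>2 * varpi M Pb x"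
  shows "integrable (X_law M P 1 1) (\<lambda>x. g x * (mu M P x - mu M Pb x))"
    and "integrable (X_law M P 0 1) (\<lambda>x. xi M Pb x / (\<rho> + xi M Pb x))"
    and "(\<integral>\<omega>. phi M \<rho> Pb \<omega> \<partial>P) =
      \<P>(\<omega> in P. R1 \<omega> = 1 \<and> R2 \<omega> = 1) / \<P>(\<omega> in Pb. R1 \<omega> = 1 \<and> R2 \<omega> = 1)
        * (\<integral>x. g x * (mu M P x - mu M Pb x) \<partial>X_law M P 1 1)
      + \<P>(\<omega> in P. R1 \<omega> = 0 \<and> R2 \<omega> = 1) / \<P>(\<omega> in Pb. R1 \<omega> = 0 \<and> R2 \<omega> = 1)
        * ((\<integral>x. xi M Pb x / (\<rho> + xi M Pb x) \<partial>X_law M P 0 1) - theta M \<rho> Pb)"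
proof -
  interpret Pb: observation M Pb by fact
  note [measurable] = Pb.borel_measurable_mu Pb.borel_measurable_xi Pb.borel_measurable_varpi
  have g[measurable]: "g \<in> borel_measurable (missing_space M)"
    unfolding g_def by measurable
  let ?E11 = "{\<omega> \<in> space P. R1 \<omega> = 1 \<and> R2 \<omega> = 1}" and ?E01 = "{\<omega> \<in> space P. R1 \<omega> = 0 \<and> R2 \<omega> = 1}"
  let ?\<phi> = "phi M \<rho> Pb" and ?L = "X_law M P 1 1"
  let ?p = "\<P>(\<omega> in Pb. R1 \<omega> = 1 \<and> R2 \<omega> = 1)" and ?q = "\<P>(\<omega> in Pb. R1 \<omega> = 0 \<and> R2 \<omega> = 1)"
  let ?f = "\<lambda>x. xi M Pb x / (\<rho> + xi M Pb x)"
  let ?h = "\<lambda>\<omega>. g (X \<omega>) * (indicator Y1 \<omega> - mu M Pb (X \<omega>))"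
  have phi[measurable]: "?\<phi> \<in> borel_measurable (obs_space M)"
    using borel_measurable_integrable[OF int] by simp
  have E: "?E11 \<in> sets P" "?E01 \<in> sets P"
    by (rule event_R)+
  have i: "integrable P (\<lambda>\<omega>. indicator ?E11 \<omega> * ?\<phi> \<omega>)" "integrable P (\<lambda>\<omega>. indicator ?E01 \<omega> * ?\<phi> \<omega>)"
    using integrable_mult_indicator[OF E(1) int] integrable_mult_indicator[OF E(2) int] by simp_all
  \<comment> \<open>Both summands of \<open>phi\<close> carry the factor \<open>R2\<close>, so only
    the two patterns with \<open>R2 \<omega> = 1\<close> contribute.\<close>
  have "(\<integral>\<omega>. ?\<phi> \<omega> \<partial>P) = (\<integral>\<omega>. indicator ?E11 \<omega> * ?\<phi> \<omega> + indicator ?E01 \<omega> * ?\<phi> \<omega> \<partial>P)"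
    by (rule Bochner_Integration.integral_cong) (auto simp: indicator_def phi_def R1_def R2_def)
  also have "\<dots> = \<P>(\<omega> in P. R1 \<omega> = 1 \<and> R2 \<omega> = 1) * (\<integral>\<omega>. ?\<phi> \<omega> \<partial>Q)
      + \<P>(\<omega> in P. R1 \<omega> = 0 \<and> R2 \<omega> = 1) * (\<integral>\<omega>. ?\<phi> \<omega> \<partial>given P 0 1)"
    using pos11 pos01 i by (simp add: integral_given)
  finally have split: "(\<integral>\<omega>. ?\<phi> \<omega> \<partial>P) = \<dots>" .

  have phiQ: "integrable Q ?\<phi>"
    using i(1) pos11 by (simp add: integrable_given)
  have Yb: "AE \<omega> in Q. R1 \<omega> = 1 \<longrightarrow> Y \<omega> \<in> {Some 0, Some 1}"
    unfolding given_def
    by (subst AE_uniform_measure)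
      (use binary pos11 in \<open>auto simp: emeasure_eq_measure binary_outcome_def elim: eventually_mono\<close>)
  \<comment> \<open>For complete cases the second summand vanishes, a binary \<open>Y\<close> equals
    the indicator of \<open>Y1\<close>, and odds / (1 + odds) recovers the probability
    \<open>mu M Pb\<close>.\<close>
  have ae11: "AE \<omega> in Q. ?\<phi> \<omega> = ?h \<omega> / ?p"
    using Yb AE_given[of 1 1] AE_X_law[OF mub] AE_space
  proof eventually_elim
    case (elim \<omega>)
    have "xi M Pb (X \<omega>) / (1 + xi M Pb (X \<omega>)) = mu M Pb (X \<omega>)"
      using elim by (simp add: xi_def odds_def field_simps)
    moreover have "the (Y \<omega>) = indicator Y1 \<omega>"
      using elim by (auto simp: indicator_def)
    ultimately show ?case
      using elim by (simp add: phi_def g_def)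
  qed
  have hm: "?h \<in> borel_measurable Q"
    by (intro borel_measurable_times borel_measurable_diff borel_measurable_indicator)
      (use event_Y[of 1] in \<open>simp_all, measurable\<close>)
  have "integrable Q (\<lambda>\<omega>. ?h \<omega> / ?p)"
    using phiQ by (subst integrable_cong_AE[OF _ _ ae11, symmetric]) (use hm in auto)
  then have h: "integrable Q ?h"
    using posb by (simp add: divide_inverse)
  show "integrable ?L (\<lambda>x. g x * (mu M P x - mu M Pb x))"
    by (rule integrable_residual[OF g Pb.borel_measurable_mu h])
  have eq11: "(\<integral>\<omega>. ?\<phi> \<omega> \<partial>Q) = (\<integral>x. g x * (mu M P x - mu M Pb x) \<partial>?L) / ?p"
    unfolding integral_residual[OF g Pb.borel_measurable_mu h, symmetric]
    by (subst integral_cong_AE[OF _ _ ae11]) (use hm in auto)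

  interpret G: prob_space "given P 0 1" by (rule prob_space_given[OF pos01])
  \<comment> \<open>Here \<open>Y\<close> is missing and \<open>the (Y \<omega>)\<close> is an
    unspecified real, but it is multiplied by \<open>R1 \<omega> = 0\<close>.\<close>
  have ae01: "AE \<omega> in given P 0 1. ?\<phi> \<omega> = (?f (X \<omega>) - theta M \<rho> Pb) / ?q"
    using AE_given[of 0 1] by eventually_elim (simp add: phi_def)
  have fm: "(\<lambda>\<omega>. (?f (X \<omega>) - theta M \<rho> Pb) / ?q) \<in> borel_measurable (given P 0 1)"
    by measurable
  have phi01: "?\<phi> \<in> borel_measurable (given P 0 1)"
    by simp
  note eq01 = integral_cong_AE[OF phi01 fm ae01]
  note integrable_cong_AE[OF phi01 fm ae01]
  then have "integrable (given P 0 1) (\<lambda>\<omega>. (?f (X \<omega>) - theta M \<rho> Pb) / ?q)"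
    using i(2) pos01 by (simp add: integrable_given)
  \<comment> \<open>Undoing the scaling by \<open>?q\<close> and the shift by \<open>theta\<close>
    isolates \<open>?f\<close>; the added constant is integrable over a probability space.\<close>
  then have "integrable (given P 0 1) (\<lambda>\<omega>. ?q * ((?f (X \<omega>) - theta M \<rho> Pb) / ?q) + theta M \<rho> Pb)"
    by (intro Bochner_Integration.integrable_add integrable_mult_right) auto
  then have f: "integrable (given P 0 1) (\<lambda>\<omega>. ?f (X \<omega>))"
    using posb by simp
  then show "integrable (X_law M P 0 1) ?f"
    by (subst integral_X_law) auto
  have "(\<integral>\<omega>. ?\<phi> \<omega> \<partial>given P 0 1) = ((\<integral>x. ?f x \<partial>X_law M P 0 1) - theta M \<rho> Pb) / ?q"
    using f by (simp add: eq01 integral_X_law G.prob_space[simplified])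
  with split eq11 show "(\<integral>\<omega>. ?\<phi> \<omega> \<partial>P) =
      \<P>(\<omega> in P. R1 \<omega> = 1 \<and> R2 \<omega> = 1) / ?p * (\<integral>x. g x * (mu M P x - mu M Pb x) \<partial>?L)
      + \<P>(\<omega> in P. R1 \<omega> = 0 \<and> R2 \<omega> = 1) / ?q * ((\<integral>x. ?f x \<partial>X_law M P 0 1) - theta M \<rho> Pb)"
    by simp
qed

end

section \<open>Mean value points and the second-order terms\<close>

lemma geometric_mean_in_closed_segment:
  fixes a x y :: real
  assumes "0 < a + x" "0 < a + y"
  shows "sqrt ((a + x) * (a + y)) - a \<in> closed_segment x y"
proof -
  have *: "u \<le> sqrt (u * v) \<and> sqrt (u * v) \<le> v" if "0 < u" "u \<le> v" for u v :: real
    using that by (auto intro!: real_le_rsqrt real_le_lsqrt simp: power2_eq_square mult_mono)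
  show ?thesis
    using *[of "a + x" "a + y"] *[of "a + y" "a + x"] assms
    by (cases "x \<le> y") (auto simp: closed_segment_eq_real_ivl mult.commute)
qed

text \<open>The intermediate values are explicit: up to the shifts by 1 and \<open>\<rho>\<close> they are
  geometric means of the endpoints.\<close>

lemma second_order_terms:
  assumes "0 < mu M P x" "mu M P x < 1" "0 < mu M Pb x" "mu M Pb x < 1" "0 < \<rho>"
  shows "S2g M \<rho> Pb P x + S2f M Pb P x * \<rho> / (\<rho> + xi M Pb x)\<^sup>2 =
    \<rho> * ((1 + xi M Pb x) / (\<rho> + xi M Pb x))\<^sup>2 * (mu M P x - mu M Pb x)
      - (xi M P x / (\<rho> + xi M P x) - xi M Pb x / (\<rho> + xi M Pb x))"
proof -
  define m n a b where "m = mu M P x" "n = mu M Pb x" "a = xi M P x" "b = xi M Pb x"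
  have mn: "0 < m" "m < 1" "0 < n" "n < 1" and ab: "a = m / (1 - m)" "b = n / (1 - n)"
    using assms by (auto simp: m_n_a_b_def xi_def odds_def)
  have pos: "0 < a" "0 < b"
    using mn by (auto simp: ab)
  \<comment> \<open>Since 1 + a = 1 / (1 - m) and 1 + b = 1 / (1 - n), the mean value equation asks
    for (1 + z)^2 = (1 + a) (1 + b), which dictates the witness below.\<close>
  have "a - b = (m - n) * ((1 + a) * (1 + b))"
    using mn by (simp add: ab field_simps)
  then have "\<exists>z. z \<in> closed_segment a b \<and> a - b = (m - n) * (1 + z)\<^sup>2"
    using geometric_mean_in_closed_segment[of 1 a b] pos
    by (intro exI[of _ "sqrt ((1 + a) * (1 + b)) - 1"]) simp
  \<comment> \<open>Only the equation characterising the chosen value is kept, so any choice made by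
    \<open>SOME\<close> gives the same product. The same happens for \<open>xi''\<close> in
    2.\<close>
  then have 1: "a - b = (m - n) * (1 + xi' M Pb P x)\<^sup>2"
    unfolding xi'_def m_n_a_b_def by (rule someI2_ex) simp
  have "a / (\<rho> + a) - b / (\<rho> + b) = (a - b) * (\<rho> / ((\<rho> + a) * (\<rho> + b)))"
    using pos assms(5) by (simp add: field_simps)
  then have "\<exists>z. z \<in> closed_segment a b \<and> a / (\<rho> + a) - b / (\<rho> + b) = (a - b) * (\<rho> / (\<rho> + z)\<^sup>2)"
    using geometric_mean_in_closed_segment[of \<rho> a b] pos assms(5)
    by (intro exI[of _ "sqrt ((\<rho> + a) * (\<rho> + b)) - \<rho>"]) simp
  then have 2: "a / (\<rho> + a) - b / (\<rho> + b) = (a - b) * (\<rho> / (\<rho> + xi'' M \<rho> Pb P x)\<^sup>2)"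
    unfolding xi''_def m_n_a_b_def by (rule someI2_ex) simp
  have f: "S2f M Pb P x = (m - n) * (1 + b)\<^sup>2 - (a - b)"
    using 1 by (simp add: S2f_def m_n_a_b_def right_diff_distrib)
  have g: "S2g M \<rho> Pb P x = (a - b) * (\<rho> / (\<rho> + b)\<^sup>2) - (a / (\<rho> + a) - b / (\<rho> + b))"
    using 2 by (simp add: S2g_def m_n_a_b_def right_diff_distrib)
  \<comment> \<open>With u = a - b, B = (1 + b)^2, C = (\<rho> + b)^2 and d the difference of the
    values z / (\<rho> + z), the odds difference u cancels between \<open>S2g\<close> and the scaled
    \<open>S2f\<close>.\<close>
  have "u * (\<rho> / C) - d + ((m - n) * B - u) * \<rho> / C = \<rho> * (B / C) * (m - n) - d" for u d B C
    by (simp add: algebra_simps diff_divide_distrib add_divide_distrib)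
  then show ?thesis
    unfolding f g m_n_a_b_def[symmetric] power_divide .
qed

section \<open>Assembly of the von Mises expansion\<close>

theorem corollary2:
  fixes M :: "'x measure" and P Pb :: "'x obs measure" and \<rho> :: real
  assumes distr: "obs_distribution M P" "obs_distribution M Pb"
    and binary: "binary_outcome P" "binary_outcome Pb"
    and rho: "odds_ratio P = \<rho>" "odds_ratio Pb = \<rho>" "0 < \<rho>"
    and pos: "\<P>(\<omega> in P. R1 \<omega> = 1 \<and> R2 \<omega> = 1) > 0" "\<P>(\<omega> in P. R1 \<omega> = 0 \<and> R2 \<omega> = 1) > 0"
      "\<P>(\<omega> in Pb. R1 \<omega> = 1 \<and> R2 \<omega> = 1) > 0" "\<P>(\<omega> in Pb. R1 \<omega> = 0 \<and> R2 \<omega> = 1) > 0"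
    and mu: "AE x in X_law M P 1 1. 0 < mu M P x \<and> mu M P x < 1"
      "AE x in X_law M Pb 1 1. 0 < mu M Pb x \<and> mu M Pb x < 1"
    and varpi_exists: "absolutely_continuous (X_law M P 1 1) (X_law M P 0 1)"
      "absolutely_continuous (X_law M Pb 1 1) (X_law M Pb 0 1)"
    and equiv_laws: "absolutely_continuous (X_law M P 1 1) (X_law M Pb 1 1)"
      "absolutely_continuous (X_law M Pb 1 1) (X_law M P 1 1)"
    and integrable: "integrable Pb (phi M \<rho> Pb)" "integrable P (phi M \<rho> Pb)"
      "integrable (X_law M P 1 1) (\<lambda>x.
           (xi M P x / (\<rho> + xi M P x) - xi M Pb x / (\<rho> + xi M Pb x)) * (varpi M Pb x - varpi M P x))"
      "integrable (X_law M P 1 1) (\<lambda>x.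
           (S2g M \<rho> Pb P x + S2f M Pb P x * \<rho> / (\<rho> + xi M Pb x)\<^sup>2) * varpi M Pb x)"
  shows "(\<integral>\<omega>. phi M \<rho> Pb \<omega> \<partial>Pb) = 0 \<and>
    theta M \<rho> Pb - theta M \<rho> P =
      ((\<integral>\<omega>. phi M \<rho> Pb \<omega> \<partial>Pb) - (\<integral>\<omega>. phi M \<rho> Pb \<omega> \<partial>P)) + remainder M \<rho> Pb P"
proof -
  interpret P: outcome_observation M P
    by unfold_locales (use distr pos mu in auto)
  interpret Pb: outcome_observation M Pb
    by unfold_locales (use distr pos mu in auto)
  note [measurable] = P.borel_measurable_mu P.borel_measurable_xi P.borel_measurable_varpi
    Pb.borel_measurable_mu Pb.borel_measurable_xi Pb.borel_measurable_varpi
  let ?f = "\<lambda>x. xi M P x / (\<rho> + xi M P x)" and ?fb = "\<lambda>x. xi M Pb x / (\<rho> + xi M Pb x)"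
  let ?g = "\<lambda>x. \<rho> * ((1 + xi M Pb x) / (\<rho> + xi M Pb x))\<^sup>2 * varpi M Pb x"
  let ?S = "\<lambda>x. (S2g M \<rho> Pb P x + S2f M Pb P x * \<rho> / (\<rho> + xi M Pb x)\<^sup>2) * varpi M Pb x"
  let ?L = "X_law M P 1 1" and ?K = "X_law M P 0 1"
  let ?res = "\<lambda>x. ?g x * (mu M P x - mu M Pb x)"
  \<comment> \<open>Null sets of the barred covariate law are null for \<open>?L\<close>, so the
    barred bounds carry over.\<close>
  have mub: "AE x in ?L. 0 < mu M Pb x \<and> mu M Pb x < 1"
    by (rule absolutely_continuous_AE[OF _ equiv_laws(2) mu(2)]) simp

  \<comment> \<open>With \<open>Pb\<close> in both roles the residual integrand is identically 0,
    and the remaining bracket is \<open>theta M \<rho> Pb\<close> minus itself by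
    \<open>thetab\<close>.\<close>
  note meanb = Pb.influence_function_mean[OF Pb.observation_axioms binary(2) pos(4,3,4) mu(2) integrable(1)]
  have thetab: "theta M \<rho> Pb = (\<integral>x. ?fb x \<partial>X_law M Pb 0 1)"
    unfolding theta_def by (rule Pb.integral_X_law(1)[symmetric]) measurable
  then have zero: "(\<integral>\<omega>. phi M \<rho> Pb \<omega> \<partial>Pb) = 0"
    using meanb(3) by simp

  note mean = P.influence_function_mean[OF Pb.observation_axioms binary(1) pos(2,3,4) mub integrable(2)]
  have theta: "theta M \<rho> P = (\<integral>x. ?f x \<partial>?K)"
    unfolding theta_def by (rule P.integral_X_law(1)[symmetric]) measurable
  have S: "AE x in ?L. ?S x = ?res x - (?f x - ?fb x) * varpi M Pb x"
    using mu(1) mub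
  proof eventually_elim
    case (elim x)
    then show ?case
      by (subst second_order_terms[OF _ _ _ _ rho(3)]) (auto simp: algebra_simps)
  qed
  have Sb: "?S \<in> borel_measurable ?L"
    by (rule borel_measurable_integrable[OF integrable(4)])
  \<comment> \<open>The separate pieces get their integrability by subtraction: \<open>?res\<close>
    minus the second remainder integrand gives \<open>U\<close>, and \<open>U\<close> minus the
    first remainder integrand gives \<open>V\<close>.\<close>
  have "integrable ?L (\<lambda>x. ?res x - (?f x - ?fb x) * varpi M Pb x)"
    by (rule integrable_cong_AE_imp[OF integrable(4)]) (use S in auto)
  from Bochner_Integration.integrable_diff[OF mean(1) this]
  have U: "integrable ?L (\<lambda>x. (?f x - ?fb x) * varpi M Pb x)"
    by simp
  have eq: "varpi M P x * (?f x - ?fb x) = (?f x - ?fb x) * varpi M Pb x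
      - (?f x - ?fb x) * (varpi M Pb x - varpi M P x)" for x
    by algebra
  have V: "integrable ?L (\<lambda>x. varpi M P x * (?f x - ?fb x))"
    unfolding eq by (rule Bochner_Integration.integrable_diff[OF U integrable(3)])
  \<comment> \<open>The weight \<open>varpi M P\<close> turns \<open>?L\<close> into
    \<open>?K\<close>.\<close>
  have d: "integrable ?K (\<lambda>x. ?f x - ?fb x)"
    and V': "(\<integral>x. varpi M P x * (?f x - ?fb x) \<partial>?L) = (\<integral>x. ?f x - ?fb x \<partial>?K)"
    unfolding P.density_varpi[OF pos(2) varpi_exists(1), symmetric] using V
    by (simp_all add: integrable_density integral_density varpi_def)
  have "(\<integral>x. (?f x - ?fb x) * (varpi M Pb x - varpi M P x) \<partial>?L) =
      (\<integral>x. (?f x - ?fb x) * varpi M Pb x - varpi M P x * (?f x - ?fb x) \<partial>?L)"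
    by (rule Bochner_Integration.integral_cong, rule refl, algebra)
  also have "\<dots> = (\<integral>x. (?f x - ?fb x) * varpi M Pb x \<partial>?L) - (\<integral>x. ?f x - ?fb x \<partial>?K)"
    unfolding V'[symmetric] by (rule Bochner_Integration.integral_diff[OF U V])
  finally have T1: "(\<integral>x. (?f x - ?fb x) * (varpi M Pb x - varpi M P x) \<partial>?L) = \<dots>" .
  have "(\<integral>x. ?S x \<partial>?L) = (\<integral>x. ?res x - (?f x - ?fb x) * varpi M Pb x \<partial>?L)"
    by (rule integral_cong_AE[OF Sb _ S]) measurable
  also have "\<dots> = (\<integral>x. ?res x \<partial>?L) - (\<integral>x. (?f x - ?fb x) * varpi M Pb x \<partial>?L)"
    by (rule Bochner_Integration.integral_diff[OF mean(1) U])
  finally have T2: "(\<integral>x. ?S x \<partial>?L) = \<dots>" .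
  \<comment> \<open>Integrability of \<open>?f\<close> under \<open>?K\<close> comes from writing it
    as (\<open>?f\<close> - \<open>?fb\<close>) + \<open>?fb\<close>.\<close>
  have D: "(\<integral>x. ?f x - ?fb x \<partial>?K) = theta M \<rho> P - (\<integral>x. ?fb x \<partial>?K)"
    using Bochner_Integration.integral_diff[OF Bochner_Integration.integrable_add[OF d mean(2)] mean(2)]
    by (simp add: theta)
  have D': "(\<integral>x. ?fb x - ?f x \<partial>?K) = (\<integral>x. ?fb x \<partial>?K) - theta M \<rho> P"
    using Bochner_Integration.integral_minus[of ?K "\<lambda>x. ?f x - ?fb x"] D by simp
  show ?thesis
    \<comment> \<open>The integral of \<open>?res\<close> cancels against the mean of
      \<open>phi\<close> under \<open>P\<close>, and the integral from \<open>U\<close> cancels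
      between \<open>T1\<close> and \<open>T2\<close>. What is left is linear in the two parameters
      and the integral of \<open>?fb\<close> over \<open>?K\<close>; the coefficients of both
      probability ratios sum to 0.\<close>
    unfolding zero remainder_def Let_def P.integral_indicators Pb.integral_indicators T1 T2 D D' mean(3)
    by (simp add: algebra_simps add_divide_distrib diff_divide_distrib)
qed

end
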